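(* Let $\pi : E \to B$ be a fibred manifold whose fibres $E_x$ and base $B$ have the same dimension. Let an Ehresmann connection be given on $E$, with vertical and horizontal distributions $V, H$ and corresponding projectors $P_V, P_H$. Let $S$ and $Q$ be vertical and horizontal endomorphisms, i.e. $(1,1)$ tensor fields on $E$ with $\operatorname{im}(S) = V = \ker(S)$ and $\operatorname{im}(Q) = H = \ker(Q)$, related by $Q \circ S = P_H$ and $S \circ Q = P_V$. Put $\nabla^V_X Y := S([X, Q(Y)])$ for $X, Y \in V$ and $\nabla^H_X Y := Q([X, S(Y)])$ for $X, Y \in H$. Then $E$ has a covariant derivative given, for vector fields $X, Y$ on $E$, by \[ \nabla_X Y := \bar\nabla^V_X (P_V(Y)) + \bar\nabla^H_X (P_H(Y)), \] that is, \[ \nabla_X Y = S([P_V(X), Q(Y)]) + P_V([P_H(X), P_V(Y)]) + Q([P_H(X), S(Y)]) + P_H([P_V(X), P_H(Y)]). \]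
   Context: Everything is smooth. For a fibred manifold $\pi : E \to B$, the vertical sub-bundle $V \subset TE$ consists of the tangent spaces to the fibres, and an Ehresmann connection is a horizontal distribution $H \subset TE$ complementary to $V$, so $TE = V \oplus H$ (no completeness condition is imposed). $P_V, P_H$ are the projectors of this direct sum. A distribution $D$ is identified with the module of vector fields on $E$ with values in $D$, so "$X \in V$" means that $X$ is a vector field with values in $V$. Given a projector $P$ onto a distribution $D$ and an operator $\nabla^D_X Y$ ($X, Y \in D$) with the covariant derivative properties, its extension is \[ \bar\nabla^D_X Y := \nabla^D_{P(X)} Y + P([X - P(X), Y]) \] for arbitrary vector fields $X$ and for $Y \in D$; here $\bar\nabla^V$ uses $P = P_V$ and $\bar\nabla^H$ uses $P = P_H$. A covariant derivative on $E$ is an affine connection on the manifold $E$: an operator $\nabla_X Y$ on vector fields that is $\mathbb{R}$-linear in both arguments and satisfies $\nabla_{fX} Y = f \nabla_X Y$ and $\nabla_X (fY) = X(f) Y + f \nabla_X Y$ for every smooth function $f$ on $E$. *)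

theory Defs
  imports "HOL-Analysis.Analysis" "HOL-Library.Function_Algebras"
begin

(* Sums, differences, zero and products of functions (hence of tangent vectors, of vector
   fields and of scalar functions) are the pointwise ones of Function_Algebras. *)

section \<open>Smooth manifolds and smooth maps\<close>

(* C^k on an open subset of a finite-dimensional space: all iterated directional derivatives
   up to order k exist as total derivatives, and those of order k are continuous. *)
primrec Ck_on :: "nat \<Rightarrow> 'm::real_normed_vector set \<Rightarrow> ('m \<Rightarrow> 'n::real_normed_vector) \<Rightarrow> bool"
where
  "Ck_on 0 S f \<longleftrightarrow> continuous_on S f"
| "Ck_on (Suc k) S f \<longleftrightarrow>
     (\<forall>x\<in>S. f differentiable (at x)) \<and> (\<forall>v. Ck_on k S (\<lambda>x. frechet_derivative f (at x) v))"

definition smooth_on :: "'m::real_normed_vector set \<Rightarrow> ('m \<Rightarrow> 'n::real_normed_vector) \<Rightarrow> bool"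
  where "smooth_on S f \<longleftrightarrow> (\<forall>k. Ck_on k S f)"

type_synonym ('a, 'm) chart = "'a set \<times> ('a \<Rightarrow> 'm)"

definition chart :: "('a::topological_space, 'm::real_normed_vector) chart \<Rightarrow> bool"
  where "chart c \<longleftrightarrow> (case c of (U, \<phi>) \<Rightarrow>
     open U \<and> open (\<phi> ` U) \<and> homeomorphism U (\<phi> ` U) \<phi> (inv_into U \<phi>))"

definition smooth_transition ::
    "('a, 'm::real_normed_vector) chart \<Rightarrow> ('a, 'm) chart \<Rightarrow> bool"
  where "smooth_transition c d \<longleftrightarrow> (case c of (U, \<phi>) \<Rightarrow> case d of (V, \<psi>) \<Rightarrow>
     smooth_on (\<phi> ` (U \<inter> V)) (\<psi> \<circ> inv_into U \<phi>))"

(* The manifold is the whole (Hausdorff, second countable) type 'a; the atlas need not be maximal.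
   The model space is a finite-dimensional normed space rather than a euclidean_space because the
   latter class excludes dimension 0. The dimension of the manifold is dim (UNIV :: 'm set). *)
definition smooth_manifold ::
    "('a::{t2_space,second_countable_topology}, 'm::real_normed_vector) chart set \<Rightarrow> bool"
  where "smooth_manifold A \<longleftrightarrow>
     (\<exists>B :: 'm set. finite B \<and> span B = UNIV) \<and>
     (\<forall>c\<in>A. chart c) \<and> (\<Union>c\<in>A. fst c) = UNIV \<and>
     (\<forall>c\<in>A. \<forall>d\<in>A. smooth_transition c d)"

definition smooth_map ::
    "('a::topological_space, 'm::real_normed_vector) chart set \<Rightarrow>
     ('b::topological_space, 'n::real_normed_vector) chart set \<Rightarrow> ('a \<Rightarrow> 'b) \<Rightarrow> bool"
  where "smooth_map A B f \<longleftrightarrow> continuous_on UNIV f \<and>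
     (\<forall>(U, \<phi>)\<in>A. \<forall>(V, \<psi>)\<in>B. smooth_on (\<phi> ` (U \<inter> f -` V)) (\<psi> \<circ> f \<circ> inv_into U \<phi>))"

definition real_atlas :: "(real, real) chart set"
  where "real_atlas = {(UNIV, id)}"

definition smooth_functions ::
    "('a::topological_space, 'm::real_normed_vector) chart set \<Rightarrow> ('a \<Rightarrow> real) set"
  where "smooth_functions A = {f. smooth_map A real_atlas f}"

(* Slice charts: F is an embedded submanifold of dimension k, without boundary. *)
definition embedded_submanifold ::
    "('a::topological_space, 'm::real_normed_vector) chart set \<Rightarrow> 'a set \<Rightarrow> nat \<Rightarrow> bool"
  where "embedded_submanifold A F k \<longleftrightarrow> (\<forall>p\<in>F. \<exists>U \<phi> W. p \<in> U \<and> chart (U, \<phi>) \<and>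
     (\<forall>c\<in>A. smooth_transition (U, \<phi>) c \<and> smooth_transition c (U, \<phi>)) \<and>
     subspace W \<and> dim W = k \<and> \<phi> ` (U \<inter> F) = \<phi> ` U \<inter> W)"


section \<open>Tangent vectors and vector fields\<close>

type_synonym 'a tvec = "('a \<Rightarrow> real) \<Rightarrow> real"
type_synonym 'a vfield = "'a \<Rightarrow> 'a tvec"
type_synonym 'a endo = "'a \<Rightarrow> 'a tvec \<Rightarrow> 'a tvec"

(* Derivations at p of the algebra of smooth functions. A tangent vector is a total function on
   all functions, so its values on non-smooth functions are fixed to 0. *)
definition tangent_space ::
    "('a::topological_space, 'm::real_normed_vector) chart set \<Rightarrow> 'a \<Rightarrow> 'a tvec set"
  where "tangent_space A p = {v.
     (\<forall>f\<in>smooth_functions A. \<forall>g\<in>smooth_functions A. v (f + g) = v f + v g) \<and>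
     (\<forall>f\<in>smooth_functions A. \<forall>c. v (\<lambda>q. c * f q) = c * v f) \<and>
     (\<forall>f\<in>smooth_functions A. \<forall>g\<in>smooth_functions A. v (f * g) = f p * v g + v f * g p) \<and>
     (\<forall>f. f \<notin> smooth_functions A \<longrightarrow> v f = 0)}"

definition tscale :: "real \<Rightarrow> 'a tvec \<Rightarrow> 'a tvec"
  where "tscale c v = (\<lambda>f. c * v f)"

definition vector_fields ::
    "('a::topological_space, 'm::real_normed_vector) chart set \<Rightarrow> 'a vfield set"
  where "vector_fields A = {X. (\<forall>p. X p \<in> tangent_space A p) \<and>
     (\<forall>f\<in>smooth_functions A. (\<lambda>p. X p f) \<in> smooth_functions A)}"

definition fscale :: "('a \<Rightarrow> real) \<Rightarrow> 'a vfield \<Rightarrow> 'a vfield"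
  where "fscale f X = (\<lambda>p. tscale (f p) (X p))"

definition lie_bracket :: "'a vfield \<Rightarrow> 'a vfield \<Rightarrow> 'a vfield"
  where "lie_bracket X Y = (\<lambda>p f. X p (\<lambda>q. Y q f) - Y p (\<lambda>q. X q f))"

definition differential ::
    "('b::topological_space, 'n::real_normed_vector) chart set \<Rightarrow> ('a \<Rightarrow> 'b) \<Rightarrow> 'a tvec \<Rightarrow> 'b tvec"
  where "differential B f v = (\<lambda>g. if g \<in> smooth_functions B then v (g \<circ> f) else 0)"

definition velocity ::
    "('a::topological_space, 'm::real_normed_vector) chart set \<Rightarrow> (real \<Rightarrow> 'a) \<Rightarrow> 'a tvec"
  where "velocity A \<gamma> = (\<lambda>f. if f \<in> smooth_functions A then deriv (f \<circ> \<gamma>) 0 else 0)"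

definition tangent_to ::
    "('a::topological_space, 'm::real_normed_vector) chart set \<Rightarrow> 'a set \<Rightarrow> 'a \<Rightarrow> 'a tvec set"
  where "tangent_to A F p =
     {velocity A \<gamma> | \<gamma>. smooth_map real_atlas A \<gamma> \<and> range \<gamma> \<subseteq> F \<and> \<gamma> 0 = p}"


section \<open>Distributions, endomorphisms and connections\<close>

definition sections ::
    "('a::topological_space, 'm::real_normed_vector) chart set \<Rightarrow> ('a \<Rightarrow> 'a tvec set) \<Rightarrow>
     'a vfield set"
  where "sections A D = {X \<in> vector_fields A. \<forall>p. X p \<in> D p}"

(* Around every point there is a smooth frame: the coordinate map with respect to X 0, ..., X (k-1)
   is a bijection onto D q. Taking the frame fields globally defined loses nothing, since a local
   frame can be cut off outside a smaller neighbourhood. *)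
definition distribution ::
    "('a::topological_space, 'm::real_normed_vector) chart set \<Rightarrow> ('a \<Rightarrow> 'a tvec set) \<Rightarrow> bool"
  where "distribution A D \<longleftrightarrow> (\<exists>k::nat. \<forall>p. \<exists>U X. open U \<and> p \<in> U \<and>
     (\<forall>i<k. X i \<in> vector_fields A) \<and>
     (\<forall>q\<in>U. bij_betw (\<lambda>c. \<Sum>i<k. tscale (c i) (X i q)) ({..<k} \<rightarrow>\<^sub>E UNIV) (D q)))"

definition complementary ::
    "('a::topological_space, 'm::real_normed_vector) chart set \<Rightarrow>
     ('a \<Rightarrow> 'a tvec set) \<Rightarrow> ('a \<Rightarrow> 'a tvec set) \<Rightarrow> bool"
  where "complementary A D D' \<longleftrightarrow>
     (\<forall>p. tangent_space A p = {a + b | a b. a \<in> D p \<and> b \<in> D' p} \<and> D p \<inter> D' p = {0})"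

definition projector :: "('a \<Rightarrow> 'a tvec set) \<Rightarrow> ('a \<Rightarrow> 'a tvec set) \<Rightarrow> 'a endo"
  where "projector D D' p v = (THE a. a \<in> D p \<and> (\<exists>b\<in>D' p. v = a + b))"

definition endo_apply :: "'a endo \<Rightarrow> 'a vfield \<Rightarrow> 'a vfield"  (infixr "\<cdot>" 75)
  where "S \<cdot> X = (\<lambda>p. S p (X p))"

(* Smooth (1,1) tensor fields, as smooth fields of endomorphisms of the tangent spaces. *)
definition endomorphism_field ::
    "('a::topological_space, 'm::real_normed_vector) chart set \<Rightarrow> 'a endo \<Rightarrow> bool"
  where "endomorphism_field A S \<longleftrightarrow>
     (\<forall>p. \<forall>v\<in>tangent_space A p. S p v \<in> tangent_space A p) \<and>
     (\<forall>p. \<forall>v\<in>tangent_space A p. \<forall>w\<in>tangent_space A p. S p (v + w) = S p v + S p w) \<and>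
     (\<forall>p. \<forall>v\<in>tangent_space A p. \<forall>c. S p (tscale c v) = tscale c (S p v)) \<and>
     (\<forall>X\<in>vector_fields A. S \<cdot> X \<in> vector_fields A)"

definition endo_image ::
    "('a::topological_space, 'm::real_normed_vector) chart set \<Rightarrow> 'a endo \<Rightarrow> 'a \<Rightarrow> 'a tvec set"
  where "endo_image A S p = S p ` tangent_space A p"

definition endo_kernel ::
    "('a::topological_space, 'm::real_normed_vector) chart set \<Rightarrow> 'a endo \<Rightarrow> 'a \<Rightarrow> 'a tvec set"
  where "endo_kernel A S p = {v \<in> tangent_space A p. S p v = 0}"

(* A surjective submersion. The fibres need not be connected or compact. *)
definition fibred_manifold ::
    "('e::{t2_space,second_countable_topology}, 'm::real_normed_vector) chart set \<Rightarrow>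
     ('b::{t2_space,second_countable_topology}, 'n::real_normed_vector) chart set \<Rightarrow>
     ('e \<Rightarrow> 'b) \<Rightarrow> bool"
  where "fibred_manifold E B \<pi> \<longleftrightarrow>
     smooth_manifold E \<and> smooth_manifold B \<and> smooth_map E B \<pi> \<and> surj \<pi> \<and>
     (\<forall>p. differential B \<pi> ` tangent_space E p = tangent_space B (\<pi> p))"

definition vertical ::
    "('e::topological_space, 'm::real_normed_vector) chart set \<Rightarrow> ('e \<Rightarrow> 'b) \<Rightarrow> 'e \<Rightarrow> 'e tvec set"
  where "vertical E \<pi> p = tangent_to E (\<pi> -` {\<pi> p}) p"

definition ehresmann_connection ::
    "('e::topological_space, 'm::real_normed_vector) chart set \<Rightarrow> ('e \<Rightarrow> 'b) \<Rightarrow>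
     ('e \<Rightarrow> 'e tvec set) \<Rightarrow> bool"
  where "ehresmann_connection E \<pi> H \<longleftrightarrow> distribution E H \<and> complementary E (vertical E \<pi>) H"

(* An operator on the sections of D with the covariant derivative properties. For the full tangent
   bundle, D = tangent_space A, this is an affine connection on the manifold. *)
definition covariant_derivative ::
    "('a::topological_space, 'm::real_normed_vector) chart set \<Rightarrow> ('a \<Rightarrow> 'a tvec set) \<Rightarrow>
     ('a vfield \<Rightarrow> 'a vfield \<Rightarrow> 'a vfield) \<Rightarrow> bool"
  where "covariant_derivative A D nabla \<longleftrightarrow>
     (\<forall>X\<in>sections A D. \<forall>Y\<in>sections A D. nabla X Y \<in> sections A D) \<and>
     (\<forall>X\<in>sections A D. \<forall>X'\<in>sections A D. \<forall>Y\<in>sections A D.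
        nabla (X + X') Y = nabla X Y + nabla X' Y) \<and>
     (\<forall>X\<in>sections A D. \<forall>Y\<in>sections A D. \<forall>Y'\<in>sections A D.
        nabla X (Y + Y') = nabla X Y + nabla X Y') \<and>
     (\<forall>X\<in>sections A D. \<forall>Y\<in>sections A D. \<forall>c::real.
        nabla (fscale (\<lambda>_. c) X) Y = fscale (\<lambda>_. c) (nabla X Y) \<and>
        nabla X (fscale (\<lambda>_. c) Y) = fscale (\<lambda>_. c) (nabla X Y)) \<and>
     (\<forall>X\<in>sections A D. \<forall>Y\<in>sections A D. \<forall>f\<in>smooth_functions A.
        nabla (fscale f X) Y = fscale f (nabla X Y) \<and>
        nabla X (fscale f Y) = fscale (\<lambda>p. X p f) Y + fscale f (nabla X Y))"

definition extension ::
    "'a endo \<Rightarrow> ('a vfield \<Rightarrow> 'a vfield \<Rightarrow> 'a vfield) \<Rightarrow> 'a vfield \<Rightarrow> 'a vfield \<Rightarrow> 'a vfield"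
  where "extension P nabla X Y = nabla (P \<cdot> X) Y + P \<cdot> lie_bracket (X - P \<cdot> X) Y"

end

theory Submission
  imports Defs
begin

(* All four brackets have the form T[X, Y] for an endomorphism field T. Such a term is tensorial
   in X as soon as T X = 0, and obeys T[X, fY] = f T[X, Y] + X(f) T Y. In each case T kills the
   projection of X standing in the bracket, and the derivation terms recombine to X(f) Y because
   S Q and Q S are complementary projectors. *)

section \<open>The algebra of smooth functions\<close>

text \<open>Functions agreeing on an open set have the same derivative at each of its points, so the
  induction passes to the derivatives. The sum and product rules rely on this, since their formulas
  for \<open>frechet_derivative\<close> are only known at points of \<open>S\<close>.\<close>

lemma Ck_on_cong:
  assumes "open S" "\<And>x. x \<in> S \<Longrightarrow> f x = g x" "Ck_on k S f"
  shows "Ck_on k S g"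
  using assms(2,3)
proof (induction k arbitrary: f g)
  case 0
  then show ?case using continuous_on_cong[of S S f g] by simp
next
  case (Suc k)
  have der: "(g has_derivative frechet_derivative f (at x)) (at x)" if "x \<in> S" for x
  proof (rule has_derivative_transform_within_open[OF _ assms(1) that])
    show "(f has_derivative frechet_derivative f (at x)) (at x)"
      using Suc.prems(2) that by (simp add: frechet_derivative_works[symmetric])
  qed (use Suc.prems(1) in auto)
  have "Ck_on k S (\<lambda>x. frechet_derivative g (at x) v)" for v
  proof (rule Suc.IH)
    show "frechet_derivative f (at x) v = frechet_derivative g (at x) v" if "x \<in> S" for x
      by (simp flip: frechet_derivative_at[OF der[OF that]])
    show "Ck_on k S (\<lambda>x. frechet_derivative f (at x) v)"
      using Suc.prems(2) by simp
  qed
  then show ?case using der by (auto simp: differentiable_def)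
qed

text \<open>\<open>Ck_on\<close> asks for continuity only at the top order, so at order 0 it has to
  be recovered from differentiability.\<close>

lemma Ck_on_Suc_imp: "Ck_on (Suc k) S f \<Longrightarrow> Ck_on k S f"
proof (induction k arbitrary: f)
  case 0
  then show ?case
    by (auto intro!: continuous_at_imp_continuous_on differentiable_imp_continuous_within)
next
  case (Suc k)
  from Suc.prems have "\<forall>x\<in>S. f differentiable (at x)"
    and "\<And>v. Ck_on (Suc k) S (\<lambda>x. frechet_derivative f (at x) v)"
    by auto
  with Suc.IH show ?case by auto
qed

lemma Ck_on_const: "Ck_on k S (\<lambda>_. c)"
  by (induction k arbitrary: c) (auto simp: frechet_derivative_const)

lemma Ck_on_add:
  assumes "open S" "Ck_on k S f" "Ck_on k S g"
  shows "Ck_on k S (\<lambda>x. f x + g x)"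
  using assms(2,3)
proof (induction k arbitrary: f g)
  case 0
  then show ?case by (auto intro: continuous_intros)
next
  case (Suc k)
  have "Ck_on k S (\<lambda>x. frechet_derivative (\<lambda>x. f x + g x) (at x) v)" for v
  proof (rule Ck_on_cong[OF assms(1)])
    show "Ck_on k S (\<lambda>x. frechet_derivative f (at x) v + frechet_derivative g (at x) v)"
      using Suc by simp
    show "frechet_derivative f (at x) v + frechet_derivative g (at x) v =
        frechet_derivative (\<lambda>x. f x + g x) (at x) v" if "x \<in> S" for x
    proof -
      have "((\<lambda>x. f x + g x) has_derivative
          (\<lambda>h. frechet_derivative f (at x) h + frechet_derivative g (at x) h)) (at x)"
        using Suc.prems that
        by (intro has_derivative_add) (auto simp: frechet_derivative_works[symmetric])
      from frechet_derivative_at[OF this] show ?thesis by metis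
    qed
  qed
  with Suc.prems show ?case by auto
qed

text \<open>The Leibniz rule turns order \<open>Suc k\<close> into products of order
  \<open>k\<close>, once the undifferentiated factors are lowered by
  \<open>Ck_on_Suc_imp\<close>.\<close>

lemma Ck_on_mult:
  fixes f g :: "_ \<Rightarrow> real"
  assumes "open S" "Ck_on k S f" "Ck_on k S g"
  shows "Ck_on k S (\<lambda>x. f x * g x)"
  using assms(2,3)
proof (induction k arbitrary: f g)
  case 0
  then show ?case by (auto intro: continuous_intros)
next
  case (Suc k)
  have "Ck_on k S (\<lambda>x. frechet_derivative (\<lambda>x. f x * g x) (at x) v)" for v
  proof (rule Ck_on_cong[OF assms(1)])
    show "Ck_on k S (\<lambda>x. f x * frechet_derivative g (at x) v + frechet_derivative f (at x) v * g x)"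
      using Suc.prems Suc.prems[THEN Ck_on_Suc_imp] by (intro Ck_on_add assms(1) Suc.IH) auto
    show "f x * frechet_derivative g (at x) v + frechet_derivative f (at x) v * g x =
        frechet_derivative (\<lambda>x. f x * g x) (at x) v" if "x \<in> S" for x
    proof -
      have "((\<lambda>x. f x * g x) has_derivative
          (\<lambda>h. f x * frechet_derivative g (at x) h + frechet_derivative f (at x) h * g x)) (at x)"
        using Suc.prems that
        by (intro has_derivative_mult) (auto simp: frechet_derivative_works[symmetric])
      from frechet_derivative_at[OF this] show ?thesis by metis
    qed
  qed
  with Suc.prems show ?case by auto
qed

text \<open>The only chart of \<open>real_atlas\<close> is the identity of the line, so the preimage
  of its domain and the outer chart map both disappear.\<close>

lemma smooth_functions_iff:
  "f \<in> smooth_functions A \<longleftrightarrow> continuous_on UNIV f \<and>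
     (\<forall>(U, \<phi>)\<in>A. smooth_on (\<phi> ` U) (\<lambda>x. f (inv_into U \<phi> x)))"
  by (simp add: smooth_functions_def smooth_map_def real_atlas_def comp_def)

locale smooth_atlas =
  fixes A :: "('a::{t2_space,second_countable_topology}, 'm::real_normed_vector) chart set"
  assumes smooth_manifold: "smooth_manifold A"
begin

lemma open_chart_image: "(U, \<phi>) \<in> A \<Longrightarrow> open (\<phi> ` U)"
  using smooth_manifold by (auto simp: smooth_manifold_def chart_def)

lemma smooth_functions_const: "(\<lambda>_. c) \<in> smooth_functions A"
  by (auto simp: smooth_functions_iff smooth_on_def Ck_on_const)

lemma smooth_functions_add:
  assumes "f \<in> smooth_functions A" "g \<in> smooth_functions A"
  shows "(\<lambda>p. f p + g p) \<in> smooth_functions A"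
proof -
  have "Ck_on k (\<phi> ` U) (\<lambda>x. f (inv_into U \<phi> x) + g (inv_into U \<phi> x))"
    if "(U, \<phi>) \<in> A" for U \<phi> k
    using assms that
    by (intro Ck_on_add open_chart_image) (auto simp: smooth_functions_iff smooth_on_def)
  moreover have "continuous_on UNIV (\<lambda>p. f p + g p)"
    using assms by (intro continuous_on_add) (simp_all add: smooth_functions_iff)
  ultimately show ?thesis
    by (auto simp: smooth_functions_iff smooth_on_def)
qed

lemma smooth_functions_mult:
  assumes "f \<in> smooth_functions A" "g \<in> smooth_functions A"
  shows "(\<lambda>p. f p * g p) \<in> smooth_functions A"
proof -
  have "Ck_on k (\<phi> ` U) (\<lambda>x. f (inv_into U \<phi> x) * g (inv_into U \<phi> x))"
    if "(U, \<phi>) \<in> A" for U \<phi> k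
    using assms that
    by (intro Ck_on_mult open_chart_image) (auto simp: smooth_functions_iff smooth_on_def)
  moreover have "continuous_on UNIV (\<lambda>p. f p * g p)"
    using assms by (intro continuous_on_mult) (simp_all add: smooth_functions_iff)
  ultimately show ?thesis
    by (auto simp: smooth_functions_iff smooth_on_def)
qed

lemma smooth_functions_diff:
  assumes "f \<in> smooth_functions A" "g \<in> smooth_functions A"
  shows "(\<lambda>p. f p - g p) \<in> smooth_functions A"
  using smooth_functions_add[OF assms(1) smooth_functions_mult[OF smooth_functions_const assms(2)],
      of "-1"] by simp


section \<open>Vector fields and the Lie bracket\<close>

lemma tangent_add:
  "v \<in> tangent_space A p \<Longrightarrow> f \<in> smooth_functions A \<Longrightarrow> g \<in> smooth_functions A \<Longrightarrow>
    v (\<lambda>q. f q + g q) = v f + v g"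
  by (auto simp: tangent_space_def plus_fun_def)

lemma tangent_scale:
  "v \<in> tangent_space A p \<Longrightarrow> f \<in> smooth_functions A \<Longrightarrow> v (\<lambda>q. c * f q) = c * v f"
  by (auto simp: tangent_space_def)

lemma tangent_mult:
  "v \<in> tangent_space A p \<Longrightarrow> f \<in> smooth_functions A \<Longrightarrow> g \<in> smooth_functions A \<Longrightarrow>
    v (\<lambda>q. f q * g q) = f p * v g + v f * g p"
  by (auto simp: tangent_space_def times_fun_def)

lemma tangent_nonsmooth: "v \<in> tangent_space A p \<Longrightarrow> f \<notin> smooth_functions A \<Longrightarrow> v f = 0"
  by (auto simp: tangent_space_def)

text \<open>A derivation satisfies v(1) = v(1 * 1) = 2 v(1), hence v(1) = 0; homogeneity gives the
  other constants.\<close>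

lemma tangent_const:
  assumes "v \<in> tangent_space A p"
  shows "v (\<lambda>_. c) = 0"
proof -
  have "v (\<lambda>_. 1) = 0"
    using tangent_mult[OF assms smooth_functions_const smooth_functions_const, of 1 1] by simp
  then show ?thesis
    using tangent_scale[OF assms smooth_functions_const, of c 1] by simp
qed

lemma tangent_spaceI:
  assumes "\<And>f g. f \<in> smooth_functions A \<Longrightarrow> g \<in> smooth_functions A \<Longrightarrow>
      v (\<lambda>q. f q + g q) = v f + v g"
    and "\<And>f c. f \<in> smooth_functions A \<Longrightarrow> v (\<lambda>q. c * f q) = c * v f"
    and "\<And>f g. f \<in> smooth_functions A \<Longrightarrow> g \<in> smooth_functions A \<Longrightarrow>
      v (\<lambda>q. f q * g q) = f p * v g + v f * g p"
    and "\<And>f. f \<notin> smooth_functions A \<Longrightarrow> v f = 0"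
  shows "v \<in> tangent_space A p"
  using assms by (auto simp: tangent_space_def plus_fun_def times_fun_def)

lemma tangent_space_add:
  assumes "v \<in> tangent_space A p" "w \<in> tangent_space A p"
  shows "v + w \<in> tangent_space A p"
  by (rule tangent_spaceI)
    (simp_all add: tangent_add[OF assms(1)] tangent_add[OF assms(2)]
      tangent_scale[OF assms(1)] tangent_scale[OF assms(2)]
      tangent_mult[OF assms(1)] tangent_mult[OF assms(2)]
      tangent_nonsmooth[OF assms(1)] tangent_nonsmooth[OF assms(2)] algebra_simps)

lemma tangent_space_tscale:
  assumes "v \<in> tangent_space A p"
  shows "tscale c v \<in> tangent_space A p"
  by (rule tangent_spaceI)
    (simp_all add: tscale_def tangent_add[OF assms] tangent_scale[OF assms]
      tangent_mult[OF assms] tangent_nonsmooth[OF assms] algebra_simps)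

section \<open>Smooth vector fields\<close>

lemma vector_field_tangent: "X \<in> vector_fields A \<Longrightarrow> X p \<in> tangent_space A p"
  by (auto simp: vector_fields_def)

text \<open>Off the smooth functions tangent vectors take the default value 0, so there the result
  is the zero function. Bracket identities can therefore be checked at every argument without a case
  distinction.\<close>

lemma vector_field_smooth:
  assumes "X \<in> vector_fields A"
  shows "(\<lambda>q. X q f) \<in> smooth_functions A"
proof (cases "f \<in> smooth_functions A")
  case False
  then have "(\<lambda>q. X q f) = (\<lambda>_. 0)"
    using tangent_nonsmooth[OF vector_field_tangent[OF assms]] by auto
  then show ?thesis by (simp add: smooth_functions_const)
qed (use assms in \<open>auto simp: vector_fields_def\<close>)

lemma vector_fieldI:
  assumes "\<And>p. X p \<in> tangent_space A p"
    and "\<And>f. f \<in> smooth_functions A \<Longrightarrow> (\<lambda>p. X p f) \<in> smooth_functions A"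
  shows "X \<in> vector_fields A"
  using assms by (auto simp: vector_fields_def)

lemma vector_fields_add:
  "X \<in> vector_fields A \<Longrightarrow> Y \<in> vector_fields A \<Longrightarrow> X + Y \<in> vector_fields A"
  by (rule vector_fieldI)
    (auto intro: tangent_space_add vector_field_tangent smooth_functions_add vector_field_smooth)

lemma vector_fields_fscale:
  "X \<in> vector_fields A \<Longrightarrow> f \<in> smooth_functions A \<Longrightarrow> fscale f X \<in> vector_fields A"
  by (rule vector_fieldI)
    (auto simp: fscale_def tscale_def intro: tangent_space_tscale[unfolded tscale_def]
      vector_field_tangent smooth_functions_mult vector_field_smooth)

lemma lie_bracket_vector_field:
  assumes X: "X \<in> vector_fields A" and Y: "Y \<in> vector_fields A"
  shows "lie_bracket X Y \<in> vector_fields A"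
proof (rule vector_fieldI)
  note tX = vector_field_tangent[OF X] and tY = vector_field_tangent[OF Y]
  note sX = vector_field_smooth[OF X] and sY = vector_field_smooth[OF Y]
  note rules = tangent_add[OF tX] tangent_add[OF tY] tangent_scale[OF tX] tangent_scale[OF tY]
    tangent_mult[OF tX] tangent_mult[OF tY] smooth_functions_mult sX sY
  fix p
  \<comment> \<open>In the product rule the mixed terms X(f) Y(g) and Y(f) X(g) cancel in the
    commutator. At a non-smooth argument the inner functions are constantly 0, which
    \<open>tangent_const\<close> sends to 0.\<close>
  show "lie_bracket X Y p \<in> tangent_space A p"
    by (rule tangent_spaceI)
      (simp_all add: lie_bracket_def rules tangent_nonsmooth[OF tX] tangent_nonsmooth[OF tY]
        tangent_const[OF tX] tangent_const[OF tY] algebra_simps)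
next
  fix f
  show "(\<lambda>p. lie_bracket X Y p f) \<in> smooth_functions A"
    unfolding lie_bracket_def
    by (intro smooth_functions_diff vector_field_smooth X Y)
qed

section \<open>Sum and product rules for the bracket\<close>

lemma lie_bracket_add_left:
  assumes "X \<in> vector_fields A" "X' \<in> vector_fields A" "Y \<in> vector_fields A"
  shows "lie_bracket (X + X') Y = lie_bracket X Y + lie_bracket X' Y"
  using assms
  by (simp add: lie_bracket_def fun_eq_iff vector_field_smooth
      tangent_add[OF vector_field_tangent[OF assms(3)]])

lemma lie_bracket_add_right:
  assumes "X \<in> vector_fields A" "Y \<in> vector_fields A" "Y' \<in> vector_fields A"
  shows "lie_bracket X (Y + Y') = lie_bracket X Y + lie_bracket X Y'"
  using assms
  by (simp add: lie_bracket_def fun_eq_iff vector_field_smooth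
      tangent_add[OF vector_field_tangent[OF assms(1)]])

text \<open>The correction term -Y(f) X is kept as an \<open>fscale\<close> summand with negated
  coefficient, so that additivity of an endomorphism field applies to it directly.\<close>

lemma lie_bracket_fscale_left:
  assumes "X \<in> vector_fields A" "Y \<in> vector_fields A" "f \<in> smooth_functions A"
  shows "lie_bracket (fscale f X) Y = fscale f (lie_bracket X Y) + fscale (\<lambda>p. - Y p f) X"
  using assms
  by (simp add: lie_bracket_def fun_eq_iff fscale_def tscale_def vector_field_smooth
      tangent_mult[OF vector_field_tangent[OF assms(2)]] algebra_simps)

lemma lie_bracket_fscale_right:
  assumes "X \<in> vector_fields A" "Y \<in> vector_fields A" "f \<in> smooth_functions A"
  shows "lie_bracket X (fscale f Y) = fscale f (lie_bracket X Y) + fscale (\<lambda>p. X p f) Y"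
  using assms
  by (simp add: lie_bracket_def fun_eq_iff fscale_def tscale_def vector_field_smooth
      tangent_mult[OF vector_field_tangent[OF assms(1)]] algebra_simps)


section \<open>Endomorphism fields applied to brackets\<close>

lemma endo_apply_vector_field:
  "endomorphism_field A T \<Longrightarrow> X \<in> vector_fields A \<Longrightarrow> T \<cdot> X \<in> vector_fields A"
  by (simp add: endomorphism_field_def)

lemma endo_apply_add:
  "endomorphism_field A T \<Longrightarrow> X \<in> vector_fields A \<Longrightarrow> Y \<in> vector_fields A \<Longrightarrow>
    T \<cdot> (X + Y) = T \<cdot> X + T \<cdot> Y"
  by (simp add: endomorphism_field_def endo_apply_def vector_field_tangent fun_eq_iff)

lemma endo_apply_fscale:
  "endomorphism_field A T \<Longrightarrow> X \<in> vector_fields A \<Longrightarrow> T \<cdot> fscale f X = fscale f (T \<cdot> X)"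
  by (simp add: endomorphism_field_def endo_apply_def fscale_def vector_field_tangent)

text \<open>This makes the projectors smooth: they are given by a definite description, but agree on
  tangent vectors with the composites of \<open>S\<close> and \<open>Q\<close>.\<close>

lemma endomorphism_field_comp:
  assumes "endomorphism_field A S" "endomorphism_field A T"
    and "\<And>p v. v \<in> tangent_space A p \<Longrightarrow> R p v = S p (T p v)"
  shows "endomorphism_field A R"
proof -
  have "R \<cdot> X = S \<cdot> (T \<cdot> X)" if "X \<in> vector_fields A" for X
    using that assms(3) by (simp add: endo_apply_def vector_field_tangent)
  with assms show ?thesis
    by (simp add: endomorphism_field_def tangent_space_add tangent_space_tscale)
qed

lemma endo_bracket_add_left:
  assumes "endomorphism_field A T" "X \<in> vector_fields A" "X' \<in> vector_fields A"
    "Y \<in> vector_fields A"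
  shows "T \<cdot> lie_bracket (X + X') Y = T \<cdot> lie_bracket X Y + T \<cdot> lie_bracket X' Y"
  using assms by (simp add: lie_bracket_add_left endo_apply_add lie_bracket_vector_field)

lemma endo_bracket_add_right:
  assumes "endomorphism_field A T" "X \<in> vector_fields A" "Y \<in> vector_fields A"
    "Y' \<in> vector_fields A"
  shows "T \<cdot> lie_bracket X (Y + Y') = T \<cdot> lie_bracket X Y + T \<cdot> lie_bracket X Y'"
  using assms by (simp add: lie_bracket_add_right endo_apply_add lie_bracket_vector_field)

lemma endo_bracket_fscale_left:
  assumes T: "endomorphism_field A T" and X: "X \<in> vector_fields A" and Y: "Y \<in> vector_fields A"
    and f: "f \<in> smooth_functions A" and 0: "T \<cdot> X = 0"
  shows "T \<cdot> lie_bracket (fscale f X) Y = fscale f (T \<cdot> lie_bracket X Y)"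
proof -
  \<comment> \<open>With a smooth coefficient the correction term is a vector field, as
    \<open>endo_apply_add\<close> requires; it is a multiple of \<open>T \<cdot> X\<close> after
    \<open>T\<close> is applied.\<close>
  have "(\<lambda>p. - Y p f) \<in> smooth_functions A"
    using smooth_functions_mult[OF smooth_functions_const vector_field_smooth[OF Y], of "-1" f]
    by simp
  then have "T \<cdot> lie_bracket (fscale f X) Y =
      fscale f (T \<cdot> lie_bracket X Y) + fscale (\<lambda>p. - Y p f) (T \<cdot> X)"
    using T X Y f
    by (simp add: lie_bracket_fscale_left endo_apply_add endo_apply_fscale vector_fields_fscale
        lie_bracket_vector_field)
  then show ?thesis by (simp add: 0 fscale_def tscale_def fun_eq_iff)
qed

lemma endo_bracket_fscale_right:
  assumes "endomorphism_field A T" "X \<in> vector_fields A" "Y \<in> vector_fields A"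
    and "f \<in> smooth_functions A"
  shows "T \<cdot> lie_bracket X (fscale f Y) =
    fscale f (T \<cdot> lie_bracket X Y) + fscale (\<lambda>p. X p f) (T \<cdot> Y)"
  using assms
  by (simp add: lie_bracket_fscale_right endo_apply_add endo_apply_fscale vector_fields_fscale
      lie_bracket_vector_field vector_field_smooth)

text \<open>Homogeneity over the reals is the case of constant functions: in the Leibniz rule the
  term X(c) Y vanishes because derivations kill constants.\<close>

lemma covariant_derivativeI:
  assumes D: "\<And>p. D p \<subseteq> tangent_space A p"
    and "\<And>X Y. X \<in> sections A D \<Longrightarrow> Y \<in> sections A D \<Longrightarrow> N X Y \<in> sections A D"
    and "\<And>X X' Y. X \<in> sections A D \<Longrightarrow> X' \<in> sections A D \<Longrightarrow> Y \<in> sections A D \<Longrightarrow>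
      N (X + X') Y = N X Y + N X' Y"
    and "\<And>X Y Y'. X \<in> sections A D \<Longrightarrow> Y \<in> sections A D \<Longrightarrow> Y' \<in> sections A D \<Longrightarrow>
      N X (Y + Y') = N X Y + N X Y'"
    and "\<And>X Y f. X \<in> sections A D \<Longrightarrow> Y \<in> sections A D \<Longrightarrow> f \<in> smooth_functions A \<Longrightarrow>
      N (fscale f X) Y = fscale f (N X Y)"
    and leibniz: "\<And>X Y f. X \<in> sections A D \<Longrightarrow> Y \<in> sections A D \<Longrightarrow> f \<in> smooth_functions A \<Longrightarrow>
      N X (fscale f Y) = fscale (\<lambda>p. X p f) Y + fscale f (N X Y)"
  shows "covariant_derivative A D N"
proof -
  have "N X (fscale (\<lambda>_. c) Y) = fscale (\<lambda>_. c) (N X Y)"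
    if X: "X \<in> sections A D" and Y: "Y \<in> sections A D" for X Y c
  proof -
    have "X p (\<lambda>_. c) = 0" for p
      using X tangent_const[OF vector_field_tangent, of X] by (simp add: sections_def)
    then show ?thesis
      using leibniz[OF X Y smooth_functions_const, of c]
      by (simp add: fun_eq_iff fscale_def tscale_def)
  qed
  with assms show ?thesis
    by (simp add: covariant_derivative_def smooth_functions_const)
qed

text \<open>The two descriptions of \<open>D\<close> do different work: as the image of
  \<open>S\<close> it contains the values, as its kernel it gives tensoriality in \<open>X\<close>.
  The inverse property turns the derivation term X(f) S(Q(Y)) into X(f) Y. Exchanging
  \<open>S\<close> and \<open>Q\<close> covers both the vertical and the horizontal
  operator.\<close>

lemma covariant_derivative_endo_bracket:
  assumes S: "endomorphism_field A S" and Q: "endomorphism_field A Q"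
    and image: "endo_image A S = D" and kernel: "endo_kernel A S = D"
    and inverse: "\<And>p v. v \<in> D p \<Longrightarrow> S p (Q p v) = v"
  shows "covariant_derivative A D (\<lambda>X Y. S \<cdot> lie_bracket X (Q \<cdot> Y))"
proof -
  have D: "v \<in> D p \<longleftrightarrow> v \<in> tangent_space A p \<and> S p v = 0" for p v
    using kernel by (auto simp: endo_kernel_def)
  have vf: "X \<in> vector_fields A" if "X \<in> sections A D" for X
    using that by (simp add: sections_def)
  have SX: "S \<cdot> X = 0" if "X \<in> sections A D" for X
    using that by (simp add: sections_def endo_apply_def D zero_fun_def)
  have SQ: "S \<cdot> (Q \<cdot> Y) = Y" if "Y \<in> sections A D" for Y
    using that inverse by (simp add: sections_def endo_apply_def)
  note vfs = vf endo_apply_vector_field[OF Q] endo_apply_vector_field[OF S] lie_bracket_vector_field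
  show ?thesis
  proof (rule covariant_derivativeI)
    fix X Y assume X: "X \<in> sections A D" and Y: "Y \<in> sections A D"
    have "(S \<cdot> lie_bracket X (Q \<cdot> Y)) p \<in> D p" for p
      using X Y vector_field_tangent[OF lie_bracket_vector_field, of X "Q \<cdot> Y"]
      by (subst image[symmetric]) (auto simp: endo_image_def endo_apply_def[of S] vfs)
    moreover have "S \<cdot> lie_bracket X (Q \<cdot> Y) \<in> vector_fields A"
      using X Y by (simp add: vfs)
    ultimately show "S \<cdot> lie_bracket X (Q \<cdot> Y) \<in> sections A D"
      by (simp add: sections_def)
  next
    fix X Y f assume "X \<in> sections A D" "Y \<in> sections A D" "f \<in> smooth_functions A"
    then show "S \<cdot> lie_bracket X (Q \<cdot> fscale f Y) =
        fscale (\<lambda>p. X p f) Y + fscale f (S \<cdot> lie_bracket X (Q \<cdot> Y))"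
      using S Q by (simp add: endo_apply_fscale endo_bracket_fscale_right vfs SQ add.commute)
  qed (use S Q in \<open>simp_all add: D subset_iff endo_apply_add endo_bracket_add_left
      endo_bracket_add_right endo_bracket_fscale_left vfs SX\<close>)
qed

end

theorem theorem4p1:
  fixes E :: "('e::{t2_space,second_countable_topology}, 'm::real_normed_vector) chart set"
    and B :: "('b::{t2_space,second_countable_topology}, 'n::real_normed_vector) chart set"
    and \<pi> :: "'e \<Rightarrow> 'b"
    and V H :: "'e \<Rightarrow> 'e tvec set"
    and P\<^sub>V P\<^sub>H S Q :: "'e endo"
    and nablaV nablaH nabla :: "'e vfield \<Rightarrow> 'e vfield \<Rightarrow> 'e vfield"
  assumes "fibred_manifold E B \<pi>"
    and "\<forall>x. embedded_submanifold E (\<pi> -` {x}) (dim (UNIV :: 'n set))"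
    and "ehresmann_connection E \<pi> H"
    and "V = vertical E \<pi>"
    and "P\<^sub>V = projector V H" and "P\<^sub>H = projector H V"
    and "endomorphism_field E S" and "endo_image E S = V" and "endo_kernel E S = V"
    and "endomorphism_field E Q" and "endo_image E Q = H" and "endo_kernel E Q = H"
    and "\<forall>p. \<forall>v\<in>tangent_space E p. Q p (S p v) = P\<^sub>H p v"
    and "\<forall>p. \<forall>v\<in>tangent_space E p. S p (Q p v) = P\<^sub>V p v"
    and "nablaV = (\<lambda>X Y. S \<cdot> lie_bracket X (Q \<cdot> Y))"
    and "nablaH = (\<lambda>X Y. Q \<cdot> lie_bracket X (S \<cdot> Y))"
    and "nabla = (\<lambda>X Y. extension P\<^sub>V nablaV X (P\<^sub>V \<cdot> Y) + extension P\<^sub>H nablaH X (P\<^sub>H \<cdot> Y))"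
  shows "covariant_derivative E V nablaV \<and> covariant_derivative E H nablaH \<and>
    covariant_derivative E (tangent_space E) nabla \<and>
    (\<forall>X\<in>vector_fields E. \<forall>Y\<in>vector_fields E.
       nabla X Y =
         S \<cdot> lie_bracket (P\<^sub>V \<cdot> X) (Q \<cdot> Y) + P\<^sub>V \<cdot> lie_bracket (P\<^sub>H \<cdot> X) (P\<^sub>V \<cdot> Y) +
         Q \<cdot> lie_bracket (P\<^sub>H \<cdot> X) (S \<cdot> Y) + P\<^sub>H \<cdot> lie_bracket (P\<^sub>V \<cdot> X) (P\<^sub>H \<cdot> Y))"
proof -
  interpret smooth_atlas E
    using assms(1) by unfold_locales (simp add: fibred_manifold_def)
  note S = assms(7) and Q = assms(10)
  have V: "v \<in> V p \<longleftrightarrow> v \<in> tangent_space E p \<and> S p v = 0" for p v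
    using assms(9) by (auto simp: endo_kernel_def)
  have H: "v \<in> H p \<longleftrightarrow> v \<in> tangent_space E p \<and> Q p v = 0" for p v
    using assms(12) by (auto simp: endo_kernel_def)
  have PV: "P\<^sub>V p v = S p (Q p v)" and PH: "P\<^sub>H p v = Q p (S p v)"
    if "v \<in> tangent_space E p" for p v
    using assms(13,14) that by auto
  have EPV: "endomorphism_field E P\<^sub>V" and EPH: "endomorphism_field E P\<^sub>H"
    using endomorphism_field_comp S Q PV PH by blast+

  \<comment> \<open>The direct sum decomposition and its projectors\<close>
  have comp: "tangent_space E p = {a + b | a b. a \<in> V p \<and> b \<in> H p}" and zero: "V p \<inter> H p = {0}"
    for p
    using assms(3,4) by (auto simp: ehresmann_connection_def complementary_def)
  have add: "T p (v + w) = T p v + T p w" and scale: "T p (tscale c v) = tscale c (T p v)"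
    if "endomorphism_field E T" "v \<in> tangent_space E p" "w \<in> tangent_space E p" for T p v w c
    using that by (auto simp: endomorphism_field_def)
  have tscale_0: "tscale c 0 = 0" for c
    by (simp add: tscale_def fun_eq_iff)
  \<comment> \<open>Both distributions are kernels, hence closed under differences. The difference
    is spelled with \<open>tscale\<close> because linearity of endomorphism fields is stated for
    sums and scalar multiples.\<close>
  have diff: "a + tscale (-1) b \<in> D p"
    if "D = V \<or> D = H" "a \<in> D p" "b \<in> D p" for D p a b
    using that add[OF S] add[OF Q] scale[OF S] scale[OF Q]
    by (auto simp: V H tangent_space_add tangent_space_tscale tscale_0)
  \<comment> \<open>Moving terms across the equation gives a - a' = b' - b, an element of both
    distributions and so 0. This uniqueness evaluates the \<open>THE\<close> in
    \<open>projector\<close>.\<close>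
  have unique: "a = a' \<and> b = b'"
    if ab: "a \<in> V p" "b \<in> H p" "a' \<in> V p" "b' \<in> H p" and eq: "a + b = a' + b'" for p a b a' b'
  proof -
    have fe: "a f + b f = a' f + b' f" for f
      using fun_cong[OF eq, of f] by simp
    have "a f + - a' f = b' f + - b f" for f
      using fe[of f] by linarith
    then have "a + tscale (-1) a' = b' + tscale (-1) b"
      by (simp add: fun_eq_iff tscale_def)
    then have "a + tscale (-1) a' \<in> V p \<inter> H p"
      using diff[of V a p a'] diff[of H b' p b] ab by auto
    then have "a f = a' f" for f
      using zero[of p] by (auto simp: tscale_def fun_eq_iff)
    with fe show ?thesis by auto
  qed
  have proj: "P\<^sub>V p (a + b) = a \<and> P\<^sub>H p (a + b) = b" if "a \<in> V p" "b \<in> H p" for p a b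
  proof
    show "P\<^sub>V p (a + b) = a"
      unfolding assms(5) projector_def
    proof (rule the_equality)
      fix a' assume "a' \<in> V p \<and> (\<exists>b'\<in>H p. a + b = a' + b')"
      then show "a' = a" using unique[OF that] by metis
    qed (use that in blast)
    show "P\<^sub>H p (a + b) = b"
      unfolding assms(6) projector_def
    proof (rule the_equality)
      fix b' assume "b' \<in> H p \<and> (\<exists>a'\<in>V p. a + b = b' + a')"
      then show "b' = b" using unique[OF that] by (metis add.commute)
    qed (use that in \<open>metis add.commute\<close>)
  qed
  have zero_mem: "0 \<in> V p" "0 \<in> H p" for p
    using zero[of p] by auto
  have PV_V: "P\<^sub>V p v = v" "P\<^sub>H p v = 0" if "v \<in> V p" for p v
    using proj[OF that zero_mem(2)] by auto
  have PH_H: "P\<^sub>H p v = v" "P\<^sub>V p v = 0" if "v \<in> H p" for p v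
    using proj[OF zero_mem(1) that] by auto
  have PV_mem: "P\<^sub>V p v \<in> V p" and PH_mem: "P\<^sub>H p v \<in> H p" and sum: "P\<^sub>V p v + P\<^sub>H p v = v"
    if "v \<in> tangent_space E p" for p v
    using that proj unfolding comp by auto

  have cV: "covariant_derivative E V nablaV"
    unfolding assms(15)
    \<comment> \<open>On \<open>V\<close> the composite of \<open>S\<close> after \<open>Q\<close>
      is \<open>P\<^sub>V\<close>, which is the identity there.\<close>
    by (rule covariant_derivative_endo_bracket[OF S Q assms(8,9)]) (metis PV PV_V(1) V)
  have cH: "covariant_derivative E H nablaH"
    unfolding assms(16)
    by (rule covariant_derivative_endo_bracket[OF Q S assms(11,12)]) (metis PH PH_H(1) H)

  \<comment> \<open>Projector identities on vector fields\<close>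
  have sumX: "P\<^sub>V \<cdot> X + P\<^sub>H \<cdot> X = X" if "X \<in> vector_fields E" for X
    using that sum vector_field_tangent
    by (intro ext[of "P\<^sub>V \<cdot> X + P\<^sub>H \<cdot> X"]) (simp add: endo_apply_def)
  have S_PV: "S \<cdot> (P\<^sub>V \<cdot> X) = 0" and Q_PH: "Q \<cdot> (P\<^sub>H \<cdot> X) = 0"
    and PV_PH: "P\<^sub>V \<cdot> (P\<^sub>H \<cdot> X) = 0" and PH_PV: "P\<^sub>H \<cdot> (P\<^sub>V \<cdot> X) = 0"
    and PV_PV: "P\<^sub>V \<cdot> (P\<^sub>V \<cdot> X) = P\<^sub>V \<cdot> X" and PH_PH: "P\<^sub>H \<cdot> (P\<^sub>H \<cdot> X) = P\<^sub>H \<cdot> X"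
    and SQ: "S \<cdot> (Q \<cdot> X) = P\<^sub>V \<cdot> X" and QS: "Q \<cdot> (S \<cdot> X) = P\<^sub>H \<cdot> X"
    if "X \<in> vector_fields E" for X
    using PV_mem[OF vector_field_tangent[OF that]] PH_mem[OF vector_field_tangent[OF that]]
      PV[OF vector_field_tangent[OF that]] PH[OF vector_field_tangent[OF that]] PV_V PH_H
    by (simp_all add: endo_apply_def V H zero_fun_def)
  note vf = endo_apply_vector_field[OF S] endo_apply_vector_field[OF Q]
    endo_apply_vector_field[OF EPV] endo_apply_vector_field[OF EPH]
    lie_bracket_vector_field vector_fields_add vector_fields_fscale
  \<comment> \<open>Apply \<open>Q\<close> and \<open>S\<close> to the decomposition
    \<open>sumX\<close>; each kills one summand. This removes the inner projections that
    \<open>nablaV\<close> and \<open>nablaH\<close> acquire from the arguments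
    \<open>P\<^sub>V \<cdot> Y\<close> and \<open>P\<^sub>H \<cdot> Y\<close>.\<close>
  have Q_PV: "Q \<cdot> (P\<^sub>V \<cdot> X) = Q \<cdot> X" and S_PH: "S \<cdot> (P\<^sub>H \<cdot> X) = S \<cdot> X"
    if X: "X \<in> vector_fields E" for X
    using endo_apply_add[OF Q, of "P\<^sub>V \<cdot> X" "P\<^sub>H \<cdot> X"] endo_apply_add[OF S, of "P\<^sub>V \<cdot> X" "P\<^sub>H \<cdot> X"]
    by (simp_all add: sumX X vf Q_PH S_PV)
  \<comment> \<open>The field X - P(X) in \<open>extension\<close> is the complementary projection,
    which yields the mixed brackets of the formula.\<close>
  have minus: "X - P\<^sub>V \<cdot> X = P\<^sub>H \<cdot> X" "X - P\<^sub>H \<cdot> X = P\<^sub>V \<cdot> X" if "X \<in> vector_fields E" for X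
    by (subst (1) sumX[OF that, symmetric], simp add: fun_eq_iff)+

  have formula: "nabla X Y =
      S \<cdot> lie_bracket (P\<^sub>V \<cdot> X) (Q \<cdot> Y) + P\<^sub>V \<cdot> lie_bracket (P\<^sub>H \<cdot> X) (P\<^sub>V \<cdot> Y) +
      Q \<cdot> lie_bracket (P\<^sub>H \<cdot> X) (S \<cdot> Y) + P\<^sub>H \<cdot> lie_bracket (P\<^sub>V \<cdot> X) (P\<^sub>H \<cdot> Y)"
    if "X \<in> vector_fields E" "Y \<in> vector_fields E" for X Y
    using that by (simp add: assms(15-17) extension_def minus Q_PV S_PH add.assoc)

  \<comment> \<open>The covariant derivative on the whole tangent bundle\<close>
  note ends = S Q EPV EPH
  have sec: "sections E (tangent_space E) = vector_fields E"
    by (auto simp: sections_def vector_field_tangent)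
  have "covariant_derivative E (tangent_space E) nabla"
  proof (rule covariant_derivativeI, unfold sec)
    fix X Y f
    assume X: "X \<in> vector_fields E" and Y: "Y \<in> vector_fields E" and f: "f \<in> smooth_functions E"
    \<comment> \<open>Splitting both fields gives four products, listed in the order of the four
      brackets of \<open>formula\<close>: each is the derivation term which that bracket contributes
      when \<open>Y\<close> is scaled by \<open>f\<close>.\<close>
    have "X p f * Y p g = (P\<^sub>V \<cdot> X) p f * (P\<^sub>V \<cdot> Y) p g + (P\<^sub>H \<cdot> X) p f * (P\<^sub>V \<cdot> Y) p g
        + (P\<^sub>H \<cdot> X) p f * (P\<^sub>H \<cdot> Y) p g + (P\<^sub>V \<cdot> X) p f * (P\<^sub>H \<cdot> Y) p g" for p g
      by (subst (1) sumX[OF X, symmetric], subst (1) sumX[OF Y, symmetric])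
        (simp add: algebra_simps)
    then show "nabla X (fscale f Y) = fscale (\<lambda>p. X p f) Y + fscale f (nabla X Y)"
      using X Y f
      by (simp add: formula ends endo_apply_fscale endo_bracket_fscale_right vf
          SQ QS PV_PV PH_PH)
        (simp add: fun_eq_iff fscale_def tscale_def algebra_simps)
    \<comment> \<open>Tensoriality needs each outer endomorphism to kill the projection of
      \<open>X\<close> in its bracket; these are the four facts \<open>S_PV\<close>,
      \<open>PV_PH\<close>, \<open>Q_PH\<close> and \<open>PH_PV\<close>.\<close>
    show "nabla (fscale f X) Y = fscale f (nabla X Y)"
      using X Y f
      by (simp add: formula ends endo_apply_fscale endo_bracket_fscale_left vf
          S_PV Q_PH PV_PH PH_PV)
        (simp add: fun_eq_iff fscale_def tscale_def algebra_simps)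
  qed (simp_all add: formula ends endo_apply_add endo_bracket_add_left endo_bracket_add_right vf
      algebra_simps)
  with cV cH formula show ?thesis by blast
qed

end
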